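(* Let $\mathbb{G}$ be a countable group of infinite order (i.e. countably infinite), let $\mathbb{H}$ be a subgroup of $\mathbb{G}$, and let $\mathcal{A}$ be an alphabet. Let $\mathcal{L}$ be a collection of patterns over $\mathbb{G}$ and alphabet $\mathcal{A}$ satisfying the following three properties: ($L_1$) every subpattern of an element $P\in\mathcal{L}$ also belongs to $\mathcal{L}$; ($L_2$) for every $Q\in\mathcal{L}$ and every $g\in\mathbb{G}$ there exists $P\in\mathcal{L}$ such that $Q$ is a subpattern of $P$ and $\mathrm{dom}\,P=\mathrm{dom}\,Q\cup\{g\}$; ($L_3$) for every $P\in\mathcal{L}$ and every $g\in\mathbb{H}$, the $g$-shifted pattern $gP$ belongs to $\mathcal{L}$. Then there exists an $\mathbb{H}$-subshift $X\subset\mathcal{A}^{\mathbb{G}}$ such that $\mathcal{L}(X)=\mathcal{L}$.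
   Context: An alphabet $\mathcal{A}$ is a discrete topological space with at least two elements (possibly infinite). $\mathcal{A}^{\mathbb{G}}$ is the set of all functions $x:\mathbb{G}\to\mathcal{A}$, endowed with the prodiscrete topology (the product topology of the discrete topologies on $\mathcal{A}$). For $g\in\mathbb{G}$ the $g$-shift map $\sigma^g:\mathcal{A}^{\mathbb{G}}\to\mathcal{A}^{\mathbb{G}}$ is $\sigma^g(x)(\ell)=x(g\ell)$ for all $\ell\in\mathbb{G}$. For a subgroup $\mathbb{H}$ of $\mathbb{G}$, an $\mathbb{H}$-subshift is a nonempty closed set $X\subset\mathcal{A}^{\mathbb{G}}$ with $\sigma^g(X)=X$ for all $g\in\mathbb{H}$. A pattern (over $\mathbb{G}$ and $\mathcal{A}$) is a function $P:\mathbb{L}\to\mathcal{A}$ whose domain $\mathrm{dom}\,P=\mathbb{L}$ is a finite subset of $\mathbb{G}$. A pattern $P$ is allowed for an $\mathbb{H}$-subshift $X$ if there is $x\in X$ with $x|_{\mathrm{dom}\,P}=P$. The language $\mathcal{L}(X)$ is the set of all patterns allowed for $X$. For patterns $P,Q$: $Q$ is a subpattern of $P$ if $\mathrm{dom}\,Q\subset\mathrm{dom}\,P$ and $P|_{\mathrm{dom}\,Q}=Q$. For $g\in\mathbb{H}$, the $g$-shifted pattern $gP$ of $P:\mathbb{L}\to\mathcal{A}$ has domain $g\mathbb{L}=\{g\ell:\ell\in\mathbb{L}\}$ and is given by $gP(g\ell)=P(\ell)$ for all $\ell\in\mathbb{L}$.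
   Formalization: The collection of patterns is assumed nonempty: the empty collection satisfies the three properties vacuously, but a subshift is nonempty, so its language contains the empty pattern and cannot be empty. *)

theory Defs
  imports "HOL-Analysis.Analysis" "HOL-Algebra.Coset"
begin

text \<open>
  The alphabet is a set \<open>A\<close>. A configuration over a group \<open>G\<close> is an extensional function in
  \<open>carrier G \<rightarrow>\<^sub>E A\<close>; this set is the underlying set of the prodiscrete space.
\<close>

definition alphabet :: "'a set \<Rightarrow> bool" where
  "alphabet A \<longleftrightarrow> (\<exists>a\<in>A. \<exists>b\<in>A. a \<noteq> b)"

definition prodiscrete :: "('g, 'm) monoid_scheme \<Rightarrow> 'a set \<Rightarrow> ('g \<Rightarrow> 'a) topology" where
  "prodiscrete G A = product_topology (\<lambda>_. discrete_topology A) (carrier G)"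

definition shift_map ::
    "('g, 'm) monoid_scheme \<Rightarrow> 'g \<Rightarrow> ('g \<Rightarrow> 'a) \<Rightarrow> ('g \<Rightarrow> 'a)" where
  "shift_map G g x = (\<lambda>l\<in>carrier G. x (g \<otimes>\<^bsub>G\<^esub> l))"

definition subshift ::
    "('g, 'm) monoid_scheme \<Rightarrow> 'g set \<Rightarrow> 'a set \<Rightarrow> ('g \<Rightarrow> 'a) set \<Rightarrow> bool" where
  "subshift G H A X \<longleftrightarrow>
     X \<noteq> {} \<and> closedin (prodiscrete G A) X \<and> (\<forall>g\<in>H. shift_map G g ` X = X)"

text \<open>
  A pattern is a partial map with finite domain; its domain in the sense of the library,
  \<open>dom P\<close>, may be empty.
\<close>

definition patterns :: "('g, 'm) monoid_scheme \<Rightarrow> 'a set \<Rightarrow> ('g \<rightharpoonup> 'a) set" where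
  "patterns G A = {P. finite (dom P) \<and> dom P \<subseteq> carrier G \<and> ran P \<subseteq> A}"

definition allowed :: "('g \<Rightarrow> 'a) set \<Rightarrow> ('g \<rightharpoonup> 'a) \<Rightarrow> bool" where
  "allowed X P \<longleftrightarrow> (\<exists>x\<in>X. (Some \<circ> x) |` dom P = P)"

definition language ::
    "('g, 'm) monoid_scheme \<Rightarrow> 'a set \<Rightarrow> ('g \<Rightarrow> 'a) set \<Rightarrow> ('g \<rightharpoonup> 'a) set" where
  "language G A X = {P \<in> patterns G A. allowed X P}"

definition subpattern :: "('g \<rightharpoonup> 'a) \<Rightarrow> ('g \<rightharpoonup> 'a) \<Rightarrow> bool" where
  "subpattern Q P \<longleftrightarrow> dom Q \<subseteq> dom P \<and> P |` dom Q = Q"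

definition shift_pattern ::
    "('g, 'm) monoid_scheme \<Rightarrow> 'g \<Rightarrow> ('g \<rightharpoonup> 'a) \<Rightarrow> ('g \<rightharpoonup> 'a)" where
  "shift_pattern G g P =
     (\<lambda>k. if k \<in> carrier G then P (inv\<^bsub>G\<^esub> g \<otimes>\<^bsub>G\<^esub> k) else None)"

text \<open>
  The next two lemmas are the defining properties of the shifted pattern \<open>gP\<close>: its domain is
  the translate \<open>g (dom P)\<close>, and \<open>gP(gl) = P(l)\<close>.
\<close>

lemma (in group) dom_shift_pattern:
  assumes "g \<in> carrier G" "dom P \<subseteq> carrier G"
  shows "dom (shift_pattern G g P) = g <# dom P"
proof
  show "dom (shift_pattern G g P) \<subseteq> g <# dom P"
  proof
    fix k assume "k \<in> dom (shift_pattern G g P)"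
    then have k: "k \<in> carrier G" "inv g \<otimes> k \<in> dom P"
      by (auto simp: shift_pattern_def split: if_splits)
    have "k = g \<otimes> (inv g \<otimes> k)"
      using assms(1) k(1) by (simp add: m_assoc[symmetric])
    with k(2) show "k \<in> g <# dom P"
      unfolding l_coset_def by blast
  qed
  show "g <# dom P \<subseteq> dom (shift_pattern G g P)"
    using assms by (auto simp: shift_pattern_def l_coset_def m_assoc[symmetric] subset_iff domIff)
qed

lemma (in group) shift_pattern_apply:
  assumes "g \<in> carrier G" "l \<in> carrier G"
  shows "shift_pattern G g P (g \<otimes> l) = P l"
  using assms by (simp add: shift_pattern_def m_assoc[symmetric])

end

theory Submission imports Defs
begin

text \<open>
  Take \<open>X\<close> to be the set of all configurations whose restrictions to finite subsets of the group
  belong to \<open>L\<close>. It is closed because each condition involves finitely many coordinates, and it is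
  shift invariant by \<open>L\<^sub>3\<close>. Along an enumeration of the group, \<open>L\<^sub>2\<close> extends a given \<open>P \<in> L\<close> to an
  increasing chain of patterns in \<open>L\<close> whose domains exhaust the group; the union of the chain is a
  configuration extending \<open>P\<close>, and it lies in \<open>X\<close> by \<open>L\<^sub>1\<close>.
\<close>

definition configurations_of ::
    "('g, 'm) monoid_scheme \<Rightarrow> 'a set \<Rightarrow> ('g \<rightharpoonup> 'a) set \<Rightarrow> ('g \<Rightarrow> 'a) set" where
  "configurations_of G A L =
     {x \<in> carrier G \<rightarrow>\<^sub>E A. \<forall>F. finite F \<longrightarrow> F \<subseteq> carrier G \<longrightarrow> (Some \<circ> x) |` F \<in> L}"

text \<open>Gives access to the library order on partial maps, whose transitivity and monotonicity
  of domains serve to compare stages of the chain built from \<open>L2\<close>.\<close>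

lemma subpattern_iff_map_le: "subpattern Q P \<longleftrightarrow> Q \<subseteq>\<^sub>m P"
proof
  assume "subpattern Q P"
  then have "P |` dom Q = Q"
    by (simp add: subpattern_def)
  then show "Q \<subseteq>\<^sub>m P"
    by (metis map_le_def restrict_in)
next
  assume le: "Q \<subseteq>\<^sub>m P"
  then have "(P |` dom Q) l = Q l" for l
    by (cases "l \<in> dom Q") (auto simp: map_le_def restrict_map_def domIff)
  with le show "subpattern Q P"
    by (auto simp: subpattern_def map_le_implies_dom_le)
qed

lemma restrict_configuration_in_patterns:
  assumes "x \<in> carrier G \<rightarrow>\<^sub>E A" "finite F" "F \<subseteq> carrier G"
  shows "(Some \<circ> x) |` F \<in> patterns G A"
proof -
  have "dom ((Some \<circ> x) |` F) = F"
    by (auto simp: restrict_map_def split: if_splits)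
  moreover have "ran ((Some \<circ> x) |` F) \<subseteq> A"
    using assms by (auto simp: ran_def restrict_map_def split: if_splits)
  ultimately show ?thesis
    using assms by (simp add: patterns_def)
qed

text \<open>The cylinder is a box with singleton factors over \<open>F\<close> and the full factor
  \<open>A\<close> elsewhere; as \<open>F\<close> is finite, only finitely many factors are
  proper.\<close>

lemma openin_prodiscrete_cylinder:
  assumes "x \<in> carrier G \<rightarrow>\<^sub>E A" "finite F"
  shows "openin (prodiscrete G A) {y \<in> carrier G \<rightarrow>\<^sub>E A. \<forall>l\<in>F \<inter> carrier G. y l = x l}"
proof -
  let ?S = "\<lambda>l. if l \<in> F then {x l} else A"
  have "{y \<in> carrier G \<rightarrow>\<^sub>E A. \<forall>l\<in>F \<inter> carrier G. y l = x l} = PiE (carrier G) ?S"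
    using assms(1) by (auto simp: PiE_iff extensional_def split: if_splits)
  moreover have "finite {l \<in> carrier G. ?S l \<noteq> A}"
    by (rule finite_subset[OF _ assms(2)]) auto
  moreover have "\<forall>l\<in>carrier G. ?S l \<subseteq> A"
    using assms(1) by auto
  ultimately show ?thesis
    by (simp add: prodiscrete_def openin_PiE_gen)
qed

text \<open>A configuration outside the set shows a forbidden pattern on some finite
  \<open>F\<close>, and every configuration in its cylinder over \<open>F\<close> shows the same
  pattern. Hence the complement is open.\<close>

lemma closedin_configurations_of: "closedin (prodiscrete G A) (configurations_of G A L)"
proof -
  have top: "topspace (prodiscrete G A) = carrier G \<rightarrow>\<^sub>E A"
    by (simp add: prodiscrete_def)
  have "\<exists>U. openin (prodiscrete G A) U \<and> x \<in> U \<and> U \<subseteq> (carrier G \<rightarrow>\<^sub>E A) - configurations_of G A L"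
    if x: "x \<in> (carrier G \<rightarrow>\<^sub>E A) - configurations_of G A L" for x
  proof -
    obtain F where F: "finite F" "F \<subseteq> carrier G" "(Some \<circ> x) |` F \<notin> L"
      using x by (auto simp: configurations_of_def)
    let ?U = "{y \<in> carrier G \<rightarrow>\<^sub>E A. \<forall>l\<in>F \<inter> carrier G. y l = x l}"
    have "y \<notin> configurations_of G A L" if "y \<in> ?U" for y
    proof -
      have "(Some \<circ> y) |` F = (Some \<circ> x) |` F"
        using that F(2) by (auto simp: restrict_map_def fun_eq_iff)
      with F show ?thesis
        by (auto simp: configurations_of_def)
    qed
    with x openin_prodiscrete_cylinder[of x G A F] F(1) show ?thesis
      by (intro exI[of _ ?U]) auto
  qed
  then have "openin (prodiscrete G A) ((carrier G \<rightarrow>\<^sub>E A) - configurations_of G A L)"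
    by (subst openin_subopen) blast
  then show ?thesis
    by (auto simp: closedin_def top configurations_of_def)
qed

text \<open>What the shifted configuration shows on \<open>F\<close> is what \<open>x\<close> shows
  on the translate of \<open>F\<close> by \<open>g\<close>, moved back by \<open>inv g\<close>.
  Since \<open>inv g\<close> lies in \<open>H\<close>, the closure of \<open>L\<close> under shifts
  applies.\<close>

lemma (in group) shift_map_configurations_of_subset:
  assumes "subgroup H G" "\<forall>P\<in>L. \<forall>g\<in>H. shift_pattern G g P \<in> L" "g \<in> H"
  shows "shift_map G g ` configurations_of G A L \<subseteq> configurations_of G A L"
proof (rule image_subsetI)
  fix x assume x: "x \<in> configurations_of G A L"
  have g: "g \<in> carrier G" "inv g \<in> H"
    using assms(1,3) by (auto dest: subgroup.mem_carrier subgroup.m_inv_closed)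
  have "shift_map G g x \<in> carrier G \<rightarrow>\<^sub>E A"
    using x g(1) by (auto simp: shift_map_def configurations_of_def)
  moreover have "(Some \<circ> shift_map G g x) |` F \<in> L" if F: "finite F" "F \<subseteq> carrier G" for F
  proof -
    let ?F = "(\<lambda>l. g \<otimes> l) ` F"
    have "finite ?F" "?F \<subseteq> carrier G"
      using F g(1) by auto
    then have "(Some \<circ> x) |` ?F \<in> L"
      using x by (simp add: configurations_of_def)
    then have "shift_pattern G (inv g) ((Some \<circ> x) |` ?F) \<in> L"
      using assms(2) g(2) by blast
    moreover have "shift_pattern G (inv g) ((Some \<circ> x) |` ?F) = (Some \<circ> shift_map G g x) |` F"
    proof
      fix k
      have "g \<otimes> k \<in> ?F \<longleftrightarrow> k \<in> F" if "k \<in> carrier G"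
        using that F(2) g(1) by (auto simp: subset_iff)
      then show "shift_pattern G (inv g) ((Some \<circ> x) |` ?F) k = ((Some \<circ> shift_map G g x) |` F) k"
        using F(2) g(1) by (auto simp: shift_pattern_def shift_map_def restrict_map_def)
    qed
    ultimately show ?thesis
      by simp
  qed
  ultimately show "shift_map G g x \<in> configurations_of G A L"
    by (simp add: configurations_of_def)
qed

text \<open>Inside the carrier this is cancellation; outside it both sides are
  \<open>undefined\<close>, by extensionality of \<open>x\<close>.\<close>

lemma (in group) shift_map_shift_map_inv:
  assumes "g \<in> carrier G" "x \<in> extensional (carrier G)"
  shows "shift_map G g (shift_map G (inv g) x) = x"
proof
  fix l
  show "shift_map G g (shift_map G (inv g) x) l = x l"
    using assms by (auto simp: shift_map_def m_assoc[symmetric] extensional_def)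
qed

text \<open>The reverse inclusion comes from the previous one applied to \<open>inv g\<close>: each
  \<open>x\<close> is the \<open>g\<close>-shift of its own \<open>inv g\<close>-shift.\<close>

lemma (in group) shift_map_image_configurations_of:
  assumes "subgroup H G" "\<forall>P\<in>L. \<forall>g\<in>H. shift_pattern G g P \<in> L" "g \<in> H"
  shows "shift_map G g ` configurations_of G A L = configurations_of G A L"
proof
  show "shift_map G g ` configurations_of G A L \<subseteq> configurations_of G A L"
    by (rule shift_map_configurations_of_subset[OF assms])
  have g: "g \<in> carrier G" "inv g \<in> H"
    using assms(1,3) by (auto dest: subgroup.mem_carrier subgroup.m_inv_closed)
  show "configurations_of G A L \<subseteq> shift_map G g ` configurations_of G A L"
  proof
    fix x assume x: "x \<in> configurations_of G A L"
    then have "shift_map G (inv g) x \<in> configurations_of G A L"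
      using shift_map_configurations_of_subset[OF assms(1,2) g(2)] by blast
    moreover have "x = shift_map G g (shift_map G (inv g) x)"
      using x g(1) by (simp add: shift_map_shift_map_inv configurations_of_def PiE_iff)
    ultimately show "x \<in> shift_map G g ` configurations_of G A L"
      by blast
  qed
qed

text \<open>Used twice: for the nonemptiness of the subshift and for the inclusion of
  \<open>L\<close> in its language.\<close>

lemma ex_configuration_extending:
  assumes "countable (carrier G)" "carrier G \<noteq> {}" "L \<subseteq> patterns G A"
    and L1: "\<forall>P\<in>L. \<forall>Q\<in>patterns G A. subpattern Q P \<longrightarrow> Q \<in> L"
    and L2: "\<forall>Q\<in>L. \<forall>g\<in>carrier G. \<exists>P\<in>L. subpattern Q P \<and> dom P = dom Q \<union> {g}"
    and "P \<in> L"
  shows "\<exists>x\<in>configurations_of G A L. (Some \<circ> x) |` dom P = P"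
proof -
  \<comment> \<open>A repetition in the enumeration would be harmless: adding a point already in the
    domain leaves the domain unchanged.\<close>
  let ?e = "from_nat_into (carrier G)"
  \<comment> \<open>The clause for \<open>n = 0\<close> forces the chain to start at the given
    \<open>P\<close>.\<close>
  have "\<exists>p. \<forall>n. (p n \<in> L \<and> (n = 0 \<longrightarrow> p n = P)) \<and>
      (subpattern (p n) (p (Suc n)) \<and> dom (p (Suc n)) = dom (p n) \<union> {?e n})"
  proof (rule dependent_nat_choice)
    show "\<exists>Q. Q \<in> L \<and> ((0::nat) = 0 \<longrightarrow> Q = P)"
      using \<open>P \<in> L\<close> by blast
    show "\<exists>R. (R \<in> L \<and> (Suc n = 0 \<longrightarrow> R = P)) \<and> subpattern Q R \<and> dom R = dom Q \<union> {?e n}"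
      if "Q \<in> L \<and> (n = 0 \<longrightarrow> Q = P)" for Q n
    proof -
      have "\<exists>R\<in>L. subpattern Q R \<and> dom R = dom Q \<union> {?e n}"
        using L2 from_nat_into[OF assms(2), of n] that by simp
      then show ?thesis
        by auto
    qed
  qed
  then obtain p where p: "\<forall>n. (p n \<in> L \<and> (n = 0 \<longrightarrow> p n = P)) \<and>
      (subpattern (p n) (p (Suc n)) \<and> dom (p (Suc n)) = dom (p n) \<union> {?e n})" ..
  have pL: "p n \<in> L" and le: "p n \<subseteq>\<^sub>m p (Suc n)"
    and dom: "dom (p (Suc n)) = dom (p n) \<union> {?e n}" for n
    using spec[OF p, of n] by (simp_all add: subpattern_iff_map_le)
  have p0: "p 0 = P"
    using p by simp
  have mono: "p m \<subseteq>\<^sub>m p n" if "m \<le> n" for m n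
    using that by (induction rule: dec_induct) (auto intro: le map_le_trans)
  \<comment> \<open>A stage by which \<open>l\<close> has entered the domain; the successor appears
    because \<open>?e n\<close> is added in passing from \<open>p n\<close> to
    \<open>p (Suc n)\<close>.\<close>
  define N where "N l = Suc (to_nat_on (carrier G) l)" for l
  define x where "x = (\<lambda>l\<in>carrier G. the (p (N l) l))"
  have dom_N: "l \<in> dom (p (N l))" if "l \<in> carrier G" for l
    using that dom[of "to_nat_on (carrier G) l"] assms(1) by (simp add: N_def)
  have x_eq: "p n l = Some (x l)" if "l \<in> carrier G" "l \<in> dom (p n)" for n l
  proof -
    \<comment> \<open>Both stages are defined at \<open>l\<close> and one extends the other, so the
      value does not depend on the stage.\<close>
    have "p n l = p (N l) l"
    proof (cases "n \<le> N l")
      case True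
      then show ?thesis
        using mono[OF True] that(2) by (simp add: map_le_def)
    next
      case False
      then have "p (N l) \<subseteq>\<^sub>m p n"
        by (simp add: mono)
      then show ?thesis
        using dom_N[OF that(1)] by (simp add: map_le_def)
    qed
    then show ?thesis
      using that dom_N[OF that(1)] by (auto simp: x_def)
  qed
  have x_PiE: "x \<in> carrier G \<rightarrow>\<^sub>E A"
  proof -
    have "x l \<in> A" if "l \<in> carrier G" for l
    proof -
      have "x l \<in> ran (p (N l))"
        using x_eq[OF that dom_N[OF that]] by (rule ranI)
      then show ?thesis
        using pL[of "N l"] assms(3) by (auto simp: patterns_def)
    qed
    then show ?thesis
      by (auto simp: x_def PiE_iff)
  qed
  have "(Some \<circ> x) |` F \<in> L" if F: "finite F" "F \<subseteq> carrier G" for F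
  proof -
    \<comment> \<open>Finiteness of \<open>F\<close> yields a single stage whose domain contains all
      of \<open>F\<close>; the restriction of \<open>x\<close> to \<open>F\<close> is then a
      subpattern of \<open>p n\<close>, and \<open>L1\<close> applies.\<close>
    obtain n where n: "\<forall>l\<in>F. N l \<le> n"
      using finite_nat_set_iff_bounded_le[of "N ` F"] F(1) by auto
    have "(Some \<circ> x) |` F \<subseteq>\<^sub>m p n"
    proof -
      have "p n l = Some (x l)" if "l \<in> F" for l
      proof (rule x_eq)
        show l: "l \<in> carrier G"
          using that F(2) by blast
        have "p (N l) \<subseteq>\<^sub>m p n"
          using n that by (simp add: mono)
        from map_le_implies_dom_le[OF this] dom_N[OF l] show "l \<in> dom (p n)"
          by blast
      qed
      then show ?thesis
        by (auto simp: map_le_def restrict_map_def split: if_splits)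
    qed
    then show ?thesis
      using L1 pL[of n] restrict_configuration_in_patterns[OF x_PiE F]
      by (auto simp: subpattern_iff_map_le)
  qed
  with x_PiE have "x \<in> configurations_of G A L"
    by (simp add: configurations_of_def)
  moreover have "(Some \<circ> x) |` dom P = P"
  proof
    fix l
    have "dom P \<subseteq> carrier G"
      using \<open>P \<in> L\<close> assms(3) by (auto simp: patterns_def)
    then have "P l = Some (x l)" if "l \<in> dom P"
      using x_eq[of l 0] that by (auto simp: p0)
    then show "((Some \<circ> x) |` dom P) l = P l"
      by (cases "l \<in> dom P") (simp_all add: restrict_map_def domIff)
  qed
  ultimately show ?thesis
    by blast
qed

theorem proposition2p5:
  fixes G :: "('g, 'm) monoid_scheme"
    and H :: "'g set"
    and A :: "'a set"
    and L :: "('g \<rightharpoonup> 'a) set"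
  assumes "group G"
    and "countable (carrier G)"
    and "infinite (carrier G)"
    and "subgroup H G"
    and "alphabet A"
    and "L \<subseteq> patterns G A"
    and "L \<noteq> {}"
    and L1: "\<forall>P\<in>L. \<forall>Q\<in>patterns G A. subpattern Q P \<longrightarrow> Q \<in> L"
    and L2: "\<forall>Q\<in>L. \<forall>g\<in>carrier G. \<exists>P\<in>L. subpattern Q P \<and> dom P = dom Q \<union> {g}"
    and L3: "\<forall>P\<in>L. \<forall>g\<in>H. shift_pattern G g P \<in> L"
  shows "\<exists>X. subshift G H A X \<and> language G A X = L"
proof (intro exI conjI)
  let ?X = "configurations_of G A L"
  interpret group G by fact
  have ext: "\<exists>x\<in>?X. (Some \<circ> x) |` dom P = P" if "P \<in> L" for P
    using ex_configuration_extending[OF assms(2) carrier_not_empty assms(6) L1 L2 that] .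
  then have "?X \<noteq> {}"
    using \<open>L \<noteq> {}\<close> by blast
  then show "subshift G H A ?X"
    using closedin_configurations_of shift_map_image_configurations_of[OF assms(4) L3]
    by (auto simp: subshift_def)
  show "language G A ?X = L"
  proof
    show "language G A ?X \<subseteq> L"
    proof
      fix P assume "P \<in> language G A ?X"
      then obtain x where P: "P \<in> patterns G A" and x: "x \<in> ?X" and eq: "(Some \<circ> x) |` dom P = P"
        by (auto simp: language_def allowed_def)
      have "finite (dom P)" "dom P \<subseteq> carrier G"
        using P by (auto simp: patterns_def)
      \<comment> \<open>The condition defining \<open>?X\<close> is tested on the finite set
        \<open>dom P\<close> itself.\<close>
      then have "(Some \<circ> x) |` dom P \<in> L"
        using x by (simp add: configurations_of_def)
      then show "P \<in> L"
        by (simp only: eq)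
    qed
    show "L \<subseteq> language G A ?X"
      using ext assms(6) by (auto simp: language_def allowed_def)
  qed
qed

end
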